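(* Fix an integer $d\ge1$. There exist constants $c,\delta>0$ (depending on $d$) such that for the $d$-dimensional uniform torus with $n$ vertices (side length $n^{1/d}\in\mathbb{N}$) there exists an initial load vector such that, with probability $1-o(1)$ as $n\to\infty$, there are a vertex $v$ and a time $t$ with $|x^{(t)}_v-\xi^{(t)}_v|\ge c(\log n)^{\delta}$, where $x$ is produced by the randomized rounding diffusion algorithm and $\xi$ by the idealized process (i.e. the deviation is $\Omega(\mathrm{polylog}(n))$ with probability $1-o(1)$).
   Context: The uniform $d$-dimensional torus with $n$ vertices has vertex set $\{0,\dots,m-1\}^d$ with $m=n^{1/d}$, each vertex adjacent to the $2d$ vertices obtained by changing one coordinate by $\pm1 \bmod m$; $d$ is treated as a constant. Diffusion matrix $P$: $P_{i,j}=1/(4d)$ for adjacent $i,j$, $P_{i,i}=1/2$, $0$ otherwise. Idealized process: $\xi^{(t)}=\xi^{(t-1)}P$. Discrete process: integer loads with $x^{(t)}_i=x^{(t-1)}_i-\sum_{j:\{i,j\}\in E}\Phi^{(t)}_{i,j}$, $\Phi^{(t)}_{i,j}=-\Phi^{(t)}_{j,i}$ integers. Randomized rounding diffusion algorithm: for each edge and step, orient so that $y:=P_{i,j}x^{(t-1)}_i-P_{j,i}x^{(t-1)}_j\ge0$ and set $\Phi^{(t)}_{i,j}=\lceil y\rceil$ with probability $y-\lfloor y\rfloor$, else $\lfloor y\rfloor$, independently over edges and steps. Both processes start from $x^{(0)}=\xi^{(0)}$. *)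

theory Defs
  imports "HOL-Probability.Probability"
begin

type_synonym vertex = "nat \<Rightarrow> int"

definition torus_verts :: "nat \<Rightarrow> nat \<Rightarrow> vertex set" where
  "torus_verts d m = {..<d} \<rightarrow>\<^sub>E {0..<int m}"

text \<open>The condition \<open>i \<noteq> j\<close> only matters for side length 1, where it excludes loops.\<close>

definition torus_adj :: "nat \<Rightarrow> nat \<Rightarrow> vertex \<Rightarrow> vertex \<Rightarrow> bool" where
  "torus_adj d m i j \<longleftrightarrow> i \<in> torus_verts d m \<and> j \<in> torus_verts d m \<and> i \<noteq> j \<and>
     (\<exists>k<d. j = i(k := (i k + 1) mod int m) \<or> j = i(k := (i k - 1) mod int m))"

definition torus_edges :: "nat \<Rightarrow> nat \<Rightarrow> vertex set set" where
  "torus_edges d m = {{i, j} | i j. torus_adj d m i j}"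

definition diffusion_matrix :: "nat \<Rightarrow> nat \<Rightarrow> vertex \<Rightarrow> vertex \<Rightarrow> real" where
  "diffusion_matrix d m i j =
     (if i = j then 1 / 2 else if torus_adj d m i j then 1 / (4 * real d) else 0)"

primrec ideal_load :: "nat \<Rightarrow> nat \<Rightarrow> (vertex \<Rightarrow> real) \<Rightarrow> nat \<Rightarrow> vertex \<Rightarrow> real" where
  "ideal_load d m \<xi>0 0 = \<xi>0"
| "ideal_load d m \<xi>0 (Suc t) =
     (\<lambda>j. \<Sum>i\<in>torus_verts d m. ideal_load d m \<xi>0 t i * diffusion_matrix d m i j)"

text \<open>Randomized rounding is driven by independent uniform variables on \<open>[0, 1]\<close>, one for each
  step and each (undirected) edge. An edge rounds up if its variable is below the fractional
  part, hence with exactly the prescribed probability, see \<open>distr_rand_round\<close>.\<close>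

definition rand_round :: "real \<Rightarrow> real \<Rightarrow> int" where
  "rand_round y u = (if u < y - of_int \<lfloor>y\<rfloor> then \<lceil>y\<rceil> else \<lfloor>y\<rfloor>)"

definition unif01 :: "real measure" where
  "unif01 = uniform_measure lborel {0..1}"

lemma prob_unif01: "prob_space unif01"
  unfolding unif01_def by (rule prob_space_uniform_measure) simp_all

lemma distr_rand_round:
  "distr unif01 (count_space UNIV) (rand_round y) =
     measure_pmf (map_pmf (\<lambda>b. if b then \<lceil>y\<rceil> else \<lfloor>y\<rfloor>) (bernoulli_pmf (y - of_int \<lfloor>y\<rfloor>)))"
proof -
  define p where "p = y - of_int \<lfloor>y\<rfloor>"
  have p: "0 \<le> p" "p \<le> 1" unfolding p_def by linarith+
  interpret prob_space unif01 by (rule prob_unif01)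
  have sets_u [simp, measurable_cong]: "sets unif01 = sets borel" by (simp add: unif01_def)
  have sp: "space unif01 = UNIV" by (simp add: unif01_def)
  have "distr unif01 (count_space UNIV) (\<lambda>u. u < p) = measure_pmf (bernoulli_pmf p)"
  proof (rule measure_eqI)
    fix A :: "bool set"
    have m1: "emeasure unif01 {u. u < p} = ennreal p"
    proof -
      have e: "{0..1} \<inter> {u. u < p} = {0..<p}" using p by auto
      have "emeasure unif01 {u. u < p} = emeasure lborel ({0..1} \<inter> {u. u < p}) / emeasure lborel {0..1::real}"
        unfolding unif01_def by (rule emeasure_uniform_measure) simp_all
      also have "\<dots> = ennreal p" unfolding e using p by (simp add: divide_ennreal_def)
      finally show ?thesis .
    qed
    have "prob {u. u < p} = p" using m1 p by (simp add: measure_def)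
    moreover have "{u. \<not> u < p} = space unif01 - {u. u < p}" using sp by auto
    ultimately have m2: "emeasure unif01 {u. \<not> u < p} = ennreal (1 - p)"
      using prob_compl[of "{u. u < p}"] p
      by (simp add: emeasure_eq_measure)
    have A: "A = {} \<or> A = {True} \<or> A = {False} \<or> A = UNIV"
    proof -
      have "A \<in> Pow {False, True}" by (simp flip: UNIV_bool)
      thus ?thesis by (auto simp: Pow_insert UNIV_bool)
    qed
    have "emeasure (distr unif01 (count_space UNIV) (\<lambda>u. u < p)) A = emeasure unif01 ((\<lambda>u. u < p) -` A)"
      by (subst emeasure_distr) (simp_all add: sp)
    also from A have "\<dots> = emeasure (measure_pmf (bernoulli_pmf p)) A"
    proof (elim disjE)
      assume "A = UNIV"
      thus ?thesis using emeasure_space_1 sp measure_pmf.emeasure_space_1[of "bernoulli_pmf p"] by simp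
    qed (use m1 m2 p in \<open>simp_all add: vimage_def emeasure_pmf_single\<close>)
    finally show "emeasure (distr unif01 (count_space UNIV) (\<lambda>u. u < p)) A =
      emeasure (measure_pmf (bernoulli_pmf p)) A" .
  qed simp
  hence "measure_pmf (map_pmf (\<lambda>b. if b then \<lceil>y\<rceil> else \<lfloor>y\<rfloor>) (bernoulli_pmf p)) =
     distr (distr unif01 (count_space UNIV) (\<lambda>u. u < p)) (count_space UNIV) (\<lambda>b. if b then \<lceil>y\<rceil> else \<lfloor>y\<rfloor>)"
    by (simp add: map_pmf_rep_eq)
  also have "\<dots> = distr unif01 (count_space UNIV) (rand_round y)"
    unfolding p_def by (subst distr_distr) (simp_all add: rand_round_def[abs_def] comp_def cong: if_cong)
  finally show ?thesis by (simp add: p_def)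
qed

definition rounding_space :: "nat \<Rightarrow> nat \<Rightarrow> (nat \<times> vertex set \<Rightarrow> real) measure" where
  "rounding_space d m = (\<Pi>\<^sub>M _\<in>UNIV \<times> torus_edges d m. unif01)"

text \<open>The flow over the edge \<open>{i, j}\<close> is rounded in the direction in which it is nonnegative; the
  value in the other direction is its negation.\<close>

definition rr_flow ::
  "nat \<Rightarrow> nat \<Rightarrow> (vertex \<Rightarrow> int) \<Rightarrow> (vertex set \<Rightarrow> real) \<Rightarrow> vertex \<Rightarrow> vertex \<Rightarrow> int" where
  "rr_flow d m x u i j =
     (let y = diffusion_matrix d m i j * of_int (x i) - diffusion_matrix d m j i * of_int (x j)
      in if y \<ge> 0 then rand_round y (u {i, j}) else - rand_round (- y) (u {i, j}))"

primrec rr_load ::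
  "nat \<Rightarrow> nat \<Rightarrow> (vertex \<Rightarrow> int) \<Rightarrow> (nat \<times> vertex set \<Rightarrow> real) \<Rightarrow> nat \<Rightarrow> vertex \<Rightarrow> int" where
  "rr_load d m x0 \<omega> 0 = x0"
| "rr_load d m x0 \<omega> (Suc t) =
     (\<lambda>i. rr_load d m x0 \<omega> t i -
        (\<Sum>j | torus_adj d m i j. rr_flow d m (rr_load d m x0 \<omega> t) (\<lambda>e. \<omega> (Suc t, e)) i j))"

end

theory Submission
  imports Defs "HOL-Real_Asymp.Real_Asymp"
begin

text \<open>Let the initial load be the distance \<open>\<bar>s\<bar>\<close> to a hyperplane, where \<open>s\<close> is the offset in
  coordinate 0. Neighbouring loads differ by at most 1, so every unrounded flow is \<open>0\<close> or \<open>\<plusminus> 1 / (4 d)\<close>,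
  and with positive probability all edges of a cube round to 0 during \<open>H\<close> steps. If the cube has
  radius \<open>H\<close>, nothing from outside reaches its center in that time, and the load there stays 0,
  while diffusion raises the ideal load to order \<open>a\<close> for \<open>H = d a\<^sup>2\<close>. Repeating the wedge periodically
  gives about \<open>m / (2 H + 1)\<close> disjoint, hence independent, cubes along coordinate 0. One of them
  freezes with probability tending to 1 as soon as the number of roundings in a cube, which is
  polynomial in \<open>a\<close>, is at most \<open>ln m / 2\<close>.\<close>

subsection \<open>Neighbours on the torus\<close>

lemma finite_torus_verts: "finite (torus_verts d m)"
  unfolding torus_verts_def by (intro finite_PiE) auto

lemma card_torus_verts: "card (torus_verts d m) = m ^ d"
  unfolding torus_verts_def by (subst card_PiE) auto

lemma torus_adj_sym:
  assumes "torus_adj d m i j"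
  shows "torus_adj d m j i"
proof -
  from assms obtain k where k: "k < d"
      "j = i(k := (i k + 1) mod int m) \<or> j = i(k := (i k - 1) mod int m)"
    and ij: "i \<in> torus_verts d m" "j \<in> torus_verts d m" "i \<noteq> j"
    unfolding torus_adj_def by auto
  have "i k mod int m = i k" using ij(1) k(1) by (auto simp: torus_verts_def PiE_iff)
  hence "((i k + 1) mod int m - 1) mod int m = i k" "((i k - 1) mod int m + 1) mod int m = i k"
    by (simp_all add: mod_simps)
  hence "i = j(k := (j k + 1) mod int m) \<or> i = j(k := (j k - 1) mod int m)"
    using k(2) by (auto simp: fun_eq_iff)
  thus ?thesis using ij k(1) unfolding torus_adj_def by metis
qed

lemma diffusion_matrix_adj:
  assumes "torus_adj d m i j"
  shows "diffusion_matrix d m i j = 1 / (4 * real d)" "diffusion_matrix d m j i = 1 / (4 * real d)"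
  using assms torus_adj_sym[OF assms] by (auto simp: diffusion_matrix_def torus_adj_def)

text \<open>The offset is not reduced mod \<open>m\<close>, so this is torus adjacency only away
  from the wrap-around.\<close>

definition nbr :: "vertex \<Rightarrow> nat \<times> int \<Rightarrow> vertex" where
  "nbr v = (\<lambda>(k, s). v(k := v k + s))"

lemma inj_on_nbr: "inj_on (nbr v) ({..<d} \<times> {-1, 1})"
proof (rule inj_onI)
  fix x y assume xy: "x \<in> {..<d} \<times> {-1, 1}" "y \<in> {..<d} \<times> {-1, 1}" and eq: "nbr v x = nbr v y"
  obtain k s k' s' where [simp]: "x = (k, s)" "y = (k', s')" by (metis surj_pair)
  have "nbr v x k - v k = nbr v y k - v k" "nbr v x k' - v k' = nbr v y k' - v k'" using eq by simp_all
  thus "x = y" using xy by (auto simp: nbr_def split: if_splits)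
qed

text \<open>Since every unreduced neighbour is already a vertex, the reduction mod \<open>m\<close>
  changes nothing.\<close>

lemma torus_nbrs_inner:
  assumes v: "v \<in> torus_verts d m"
    and inner: "\<And>k s. k < d \<Longrightarrow> s \<in> {-1, 1} \<Longrightarrow> nbr v (k, s) \<in> torus_verts d m"
  shows "{j. torus_adj d m v j} = nbr v ` ({..<d} \<times> {-1, 1})"
proof -
  have mod: "(v k + s) mod int m = v k + s" if "k < d" "s \<in> {-1, 1}" for k s
  proof -
    have "nbr v (k, s) k \<in> {0..<int m}"
      using PiE_mem[OF inner[OF that, unfolded torus_verts_def], of k] that(1) by simp
    thus ?thesis by (simp add: nbr_def)
  qed
  have nbr: "nbr v (k, 1) = v(k := v k + 1)" "nbr v (k, -1) = v(k := v k - 1)" for k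
    by (simp_all add: nbr_def)
  have eq: "(v k + 1) mod int m = v k + 1" "(v k - 1) mod int m = v k - 1" if "k < d" for k
    using mod[OF that, of 1] mod[OF that, of "-1"] by simp_all
  have ne: "v \<noteq> nbr v (k, s)" if "s \<in> {-1, 1}" for k s
  proof
    assume "v = nbr v (k, s)"
    hence "v k = nbr v (k, s) k" by (rule fun_cong)
    thus False using that by (auto simp: nbr_def)
  qed
  have adj: "torus_adj d m v j \<longleftrightarrow> (\<exists>k<d. j = nbr v (k, 1) \<or> j = nbr v (k, -1))" for j
  proof
    assume "torus_adj d m v j"
    thus "\<exists>k<d. j = nbr v (k, 1) \<or> j = nbr v (k, -1)"
      unfolding torus_adj_def nbr by (metis eq)
  next
    assume "\<exists>k<d. j = nbr v (k, 1) \<or> j = nbr v (k, -1)"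
    then obtain k where k: "k < d" "j = nbr v (k, 1) \<or> j = nbr v (k, -1)" by blast
    hence "j \<in> torus_verts d m" "v \<noteq> j" using inner ne by blast+
    thus "torus_adj d m v j" using k v unfolding torus_adj_def nbr by (metis eq)
  qed
  show ?thesis unfolding adj by blast
qed

text \<open>Column \<open>v\<close> of the matrix is supported on \<open>v\<close> and its
  neighbours; these are paired by coordinate so that coordinate 0 can be split off later.\<close>

lemma ideal_load_step_inner:
  assumes v: "v \<in> torus_verts d m"
    and inner: "\<And>k s. k < d \<Longrightarrow> s \<in> {-1, 1} \<Longrightarrow> nbr v (k, s) \<in> torus_verts d m"
  shows "ideal_load d m \<xi>0 (Suc t) v = ideal_load d m \<xi>0 t v / 2 +
    (\<Sum>k<d. ideal_load d m \<xi>0 t (nbr v (k, -1)) + ideal_load d m \<xi>0 t (nbr v (k, 1))) / (4 * real d)"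
proof -
  let ?f = "ideal_load d m \<xi>0 t" and ?N = "{j. torus_adj d m v j}"
  have sub: "insert v ?N \<subseteq> torus_verts d m" using v by (simp add: torus_adj_def subset_iff)
  have vN: "v \<notin> ?N" by (simp add: torus_adj_def)
  have N: "?N = nbr v ` ({..<d} \<times> {-1, 1})" using v inner by (rule torus_nbrs_inner)
  have finN: "finite ?N" by (rule finite_subset[OF _ finite_torus_verts]) (use sub in blast)
  have "ideal_load d m \<xi>0 (Suc t) v = (\<Sum>i\<in>torus_verts d m. ?f i * diffusion_matrix d m i v)" by simp
  also have "\<dots> = (\<Sum>i\<in>insert v ?N. ?f i * diffusion_matrix d m i v)"
  proof (rule sum.mono_neutral_right[OF finite_torus_verts sub])
    have "diffusion_matrix d m i v = 0" if "i \<notin> insert v ?N" for i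
      using that torus_adj_sym[of d m i v] unfolding diffusion_matrix_def by auto
    thus "\<forall>i\<in>torus_verts d m - insert v ?N. ?f i * diffusion_matrix d m i v = 0" by simp
  qed
  also have "\<dots> = ?f v / 2 + (\<Sum>i\<in>?N. ?f i * diffusion_matrix d m i v)"
    unfolding sum.insert[OF finN vN] by (simp add: diffusion_matrix_def[of d m v v])
  also have "(\<Sum>i\<in>?N. ?f i * diffusion_matrix d m i v) = (\<Sum>i\<in>?N. ?f i / (4 * real d))"
    by (intro sum.cong refl) (simp add: diffusion_matrix_adj(2))
  also have "\<dots> = (\<Sum>i\<in>?N. ?f i) / (4 * real d)" by (simp add: sum_divide_distrib)
  also have "(\<Sum>i\<in>?N. ?f i) = (\<Sum>ks\<in>{..<d} \<times> {-1, 1}. ?f (nbr v ks))"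
    unfolding N by (subst sum.reindex[OF inj_on_nbr]) (simp only: comp_def)
  also have "\<dots> = (\<Sum>k<d. \<Sum>s\<in>{-1, 1}. ?f (nbr v (k, s)))"
    unfolding sum.cartesian_product by (rule sum.cong) auto
  also have "\<dots> = (\<Sum>k<d. ?f (nbr v (k, -1)) + ?f (nbr v (k, 1)))" by simp
  finally show ?thesis .
qed

subsection \<open>A wedge that rounding freezes and diffusion lifts\<close>

text \<open>A maximum-norm ball without wrap-around; \<open>extensional\<close> matches the
  representation of torus vertices.\<close>

definition cube :: "nat \<Rightarrow> vertex \<Rightarrow> int \<Rightarrow> vertex set" where
  "cube d c r = {v \<in> extensional {..<d}. \<forall>k<d. \<bar>v k - c k\<bar> \<le> r}"

lemma nbr_in_cube:
  assumes "v \<in> cube d c r" "k < d" "s \<in> {-1, 1}"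
  shows "nbr v (k, s) \<in> cube d c (r + 1)"
  using assms by (auto simp: cube_def nbr_def extensional_def)

lemma cube_mono: "r \<le> r' \<Longrightarrow> cube d c r \<subseteq> cube d c r'"
  by (force simp: cube_def)

text \<open>Where the wedge is intact, an unrounded flow is at most \<open>1 / (4 * real d)\<close>
  in absolute value, so a uniform variable at least that large rounds it to 0. A step looks only at
  neighbours, hence the region under control loses one layer per step.\<close>

lemma rr_load_frozen:
  assumes "d \<ge> 1"
    and cube: "cube d c (int H) \<subseteq> torus_verts d m"
    and x0: "\<And>v. v \<in> cube d c (int H) \<Longrightarrow> x0 v = \<bar>v 0 - c 0\<bar>"
    and \<omega>: "\<And>t e. t < H \<Longrightarrow> e \<in> torus_edges d m \<Longrightarrow> e \<subseteq> cube d c (int H) \<Longrightarrow> \<omega> (Suc t, e) \<ge> 1 / (4 * real d)"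
  shows "t \<le> H \<Longrightarrow> v \<in> cube d c (int H - int t) \<Longrightarrow> rr_load d m x0 \<omega> t v = \<bar>v 0 - c 0\<bar>"
proof (induction t arbitrary: v)
  case 0
  thus ?case using x0 by simp
next
  case (Suc t)
  have v1: "v \<in> cube d c (int H - int t)" and vH: "v \<in> cube d c (int H)"
    by (rule subsetD[OF cube_mono Suc.prems(2)]; simp)+
  have n1: "nbr v (k, s) \<in> cube d c (int H - int t)" if "k < d" "s \<in> {-1, 1}" for k s
    using nbr_in_cube[OF Suc.prems(2) that] by simp
  have nH: "nbr v (k, s) \<in> cube d c (int H)" if "k < d" "s \<in> {-1, 1}" for k s
    using n1[OF that] cube_mono[of "int H - int t" "int H"] by auto
  have N: "{j. torus_adj d m v j} = nbr v ` ({..<d} \<times> {-1, 1})"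
    using vH nH cube by (intro torus_nbrs_inner) blast+
  have IH: "rr_load d m x0 \<omega> t w = \<bar>w 0 - c 0\<bar>" if "w \<in> cube d c (int H - int t)" for w
    using Suc that by simp
  have flow: "rr_flow d m (rr_load d m x0 \<omega> t) (\<lambda>e. \<omega> (Suc t, e)) v j = 0" if j: "torus_adj d m v j" for j
  proof -
    from j N have "j \<in> nbr v ` ({..<d} \<times> {-1, 1})" by blast
    then obtain k s where ks: "k < d" "s \<in> {-1, 1}" "j = nbr v (k, s)" by blast
    have xv: "rr_load d m x0 \<omega> t v = \<bar>v 0 - c 0\<bar>" by (rule IH[OF v1])
    have xj: "rr_load d m x0 \<omega> t j = \<bar>j 0 - c 0\<bar>" using IH n1 ks by simp
    define q where "q = 1 / (4 * real d)"
    have q: "0 < q" "q < 1" using \<open>d \<ge> 1\<close> by (auto simp: q_def)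
    have u: "\<omega> (Suc t, {v, j}) \<ge> q" unfolding q_def
      using Suc.prems(1) j vH nH ks by (intro \<omega>) (auto simp: torus_edges_def)
    have rr: "rand_round y (\<omega> (Suc t, {v, j})) = 0" if "0 \<le> y" "y \<le> q" for y
    proof -
      have "\<lfloor>y\<rfloor> = 0" using that q by linarith
      thus ?thesis using that u by (simp add: rand_round_def)
    qed
    have "\<bar>rr_load d m x0 \<omega> t v - rr_load d m x0 \<omega> t j\<bar> \<le> 1"
      unfolding xv xj using ks by (auto simp: nbr_def)
    hence D: "\<bar>real_of_int (rr_load d m x0 \<omega> t v - rr_load d m x0 \<omega> t j)\<bar> \<le> 1" by linarith
    define y where "y = q * real_of_int (rr_load d m x0 \<omega> t v - rr_load d m x0 \<omega> t j)"
    have "\<bar>y\<bar> \<le> q" using D q mult_left_mono[OF D, of q] by (simp add: y_def abs_mult)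
    moreover have "diffusion_matrix d m v j * of_int (rr_load d m x0 \<omega> t v) -
        diffusion_matrix d m j v * of_int (rr_load d m x0 \<omega> t j) = y"
      unfolding diffusion_matrix_adj[OF j] y_def q_def by (simp add: algebra_simps diff_divide_distrib)
    \<comment> \<open>The flow is rounded in its nonnegative direction, so \<open>rr\<close> is
      applied to \<open>y\<close> or to \<open>-y\<close> according to the sign.\<close>
    ultimately show ?thesis using rr[of y] rr[of "-y"] by (auto simp: rr_flow_def Let_def)
  qed
  show ?case using IH[OF v1] flow by simp
qed

text \<open>The lazy walk step maps \<open>s\<^sup>2\<close> to \<open>s\<^sup>2 + h\<close> and \<open>s\<^sup>4\<close> to \<open>s\<^sup>4 + 6 h s\<^sup>2 + h\<close> with
  \<open>h = 1 / (2 d)\<close>; this is the evolution of the minorant \<open>s\<^sup>2 / a - s\<^sup>4 / (4 a\<^sup>3)\<close> of \<open>\<bar>s\<bar>\<close>.\<close>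

definition minorant :: "nat \<Rightarrow> real \<Rightarrow> nat \<Rightarrow> real \<Rightarrow> real" where
  "minorant d a t s = (let h = 1 / (2 * real d); \<tau> = real t * h in
     (s\<^sup>2 + \<tau>) / a - (s ^ 4 + 6 * \<tau> * s\<^sup>2 + 3 * \<tau>\<^sup>2 + \<tau> * (1 - 3 * h)) / (4 * a ^ 3))"

lemma minorant_0_le:
  assumes "a > 0"
  shows "minorant d a 0 s \<le> \<bar>s\<bar>"
proof -
  define u where "u = \<bar>s\<bar> / a"
  have u: "u \<ge> 0" using assms by (simp add: u_def)
  have s: "\<bar>s\<bar> = u * a" using assms by (simp add: u_def)
  have "u - u ^ 3 / 4 \<le> 1"
  proof -
    \<comment> \<open>The cubic has a double root at 6/5, a rational point near the maximiser 2 /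
      sqrt 3 of \<open>u - u ^ 3 / 4\<close>; the factor with 12/5 removes the quadratic
      term.\<close>
    have "0 \<le> (u - 6 / 5)\<^sup>2 * (u + 12 / 5)" using u by simp
    also have "\<dots> = u ^ 3 - 108 / 25 * u + 432 / 125" by algebra
    finally have "108 / 25 * u - u ^ 3 \<le> 432 / 125" by simp
    thus ?thesis using u by linarith
  qed
  hence "u * a * (u - u ^ 3 / 4) \<le> u * a * 1" using u assms by (intro mult_left_mono) auto
  moreover have "minorant d a 0 s = \<bar>s\<bar>\<^sup>2 / a - \<bar>s\<bar> ^ 4 / (4 * a ^ 3)"
    by (simp add: minorant_def Let_def)
  moreover have "\<bar>s\<bar>\<^sup>2 / a - \<bar>s\<bar> ^ 4 / (4 * a ^ 3) = u * a * (u - u ^ 3 / 4)"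
    unfolding s using assms by (simp add: field_simps power2_eq_square power3_eq_cube power4_eq_xxxx)
  ultimately show ?thesis using s by simp
qed

text \<open>A function of coordinate 0 alone has the same value at \<open>2 * d - 2\<close> of the
  neighbours, so the walk adds \<open>h\<close> times half the second difference in
  \<open>s\<close>. The minorant solves this recursion exactly.\<close>

lemma minorant_step:
  assumes "d \<ge> 1" "a > 0"
  shows "minorant d a (Suc t) s = minorant d a t s / 2 +
    ((2 * real d - 2) * minorant d a t s + (minorant d a t (s - 1) + minorant d a t (s + 1))) / (4 * real d)"
proof -
  define h where "h = 1 / (2 * real d)"
  define \<tau> where "\<tau> = real t * h"
  define A where "A = 1 / a"
  define B where "B = 1 / (4 * a ^ 3)"
  have m1: "minorant d a t s = (s\<^sup>2 + \<tau>) * A - (s ^ 4 + 6 * \<tau> * s\<^sup>2 + 3 * \<tau>\<^sup>2 + \<tau> * (1 - 3 * h)) * B" for s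
    by (simp add: minorant_def Let_def h_def \<tau>_def A_def B_def)
  have m2: "minorant d a (Suc t) s = (s\<^sup>2 + (\<tau> + h)) * A
      - (s ^ 4 + 6 * (\<tau> + h) * s\<^sup>2 + 3 * (\<tau> + h)\<^sup>2 + (\<tau> + h) * (1 - 3 * h)) * B"
  proof -
    have "real (Suc t) * (1 / (2 * real d)) = \<tau> + h"
      by (simp add: h_def \<tau>_def add_divide_distrib)
    thus ?thesis unfolding minorant_def Let_def h_def[symmetric] by (simp add: A_def B_def)
  qed
  have r: "x / 2 + ((2 * real d - 2) * x + y) / (4 * real d) = x + h * (y / 2 - x)" for x y
    using assms(1) by (simp add: h_def field_simps)
  have sum: "minorant d a t (s - 1) + minorant d a t (s + 1) =
      2 * (minorant d a t s + (A - (6 * s\<^sup>2 + 1 + 6 * \<tau>) * B))"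
    unfolding m1 by algebra
  \<comment> \<open>The term \<open>\<tau> * (1 - 3 * h)\<close> is there for this identity: it
    offsets the \<open>3 * h\<^sup>2\<close> by which the growth of
    \<open>3 * \<tau>\<^sup>2\<close> exceeds \<open>6 * \<tau> * h\<close>.\<close>
  have "minorant d a (Suc t) s = minorant d a t s + h * (A - (6 * s\<^sup>2 + 1 + 6 * \<tau>) * B)"
    unfolding m1 m2 by algebra
  thus ?thesis unfolding r sum by (simp add: field_simps)
qed

text \<open>Comparison principle: a diffusion step has nonnegative weights, so it preserves the
  inequality with the minorant, which obeys the same recursion. Shrinking the cube by one layer per
  step keeps all neighbours within the induction hypothesis.\<close>

lemma ideal_load_ge_minorant:
  assumes "d \<ge> 1" "a > 0"
    and cube: "cube d c (int H) \<subseteq> torus_verts d m"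
    and \<xi>0: "\<And>v. v \<in> cube d c (int H) \<Longrightarrow> \<xi>0 v = \<bar>real_of_int (v 0 - c 0)\<bar>"
  shows "t \<le> H \<Longrightarrow> v \<in> cube d c (int H - int t) \<Longrightarrow>
    ideal_load d m \<xi>0 t v \<ge> minorant d a t (real_of_int (v 0 - c 0))"
proof (induction t arbitrary: v)
  case 0
  thus ?case using \<xi>0 minorant_0_le[OF \<open>a > 0\<close>] by simp
next
  case (Suc t)
  let ?f = "ideal_load d m \<xi>0 t" and ?Q = "minorant d a t" and ?s = "real_of_int (v 0 - c 0)"
  have v1: "v \<in> cube d c (int H - int t)" and vH: "v \<in> cube d c (int H)"
    by (rule subsetD[OF cube_mono Suc.prems(2)]; simp)+
  have n1: "nbr v (k, s) \<in> cube d c (int H - int t)" if "k < d" "s \<in> {-1, 1}" for k s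
    using nbr_in_cube[OF Suc.prems(2) that] by simp
  have nH: "nbr v (k, s) \<in> cube d c (int H)" if "k < d" "s \<in> {-1, 1}" for k s
    using n1[OF that] cube_mono[of "int H - int t" "int H"] by auto
  have IH: "?f w \<ge> ?Q (real_of_int (w 0 - c 0))" if "w \<in> cube d c (int H - int t)" for w
    using Suc that by simp
  \<comment> \<open>Coordinate 0 is split off, the only one along which the minorant varies.\<close>
  obtain d' where d': "d = Suc d'" using \<open>d \<ge> 1\<close> by (cases d) auto
  have 0: "?Q (?s - 1) + ?Q (?s + 1) \<le> ?f (nbr v (0, -1)) + ?f (nbr v (0, 1))"
    using IH[OF n1[of 0 "-1"]] IH[OF n1[of 0 1]] \<open>d \<ge> 1\<close>
    by (simp add: nbr_def algebra_simps)
  have S: "2 * ?Q ?s \<le> ?f (nbr v (Suc k, -1)) + ?f (nbr v (Suc k, 1))" if "k < d'" for k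
    using IH[OF n1[of "Suc k" "-1"]] IH[OF n1[of "Suc k" 1]] that d' by (simp add: nbr_def)
  have "(2 * real d - 2) * ?Q ?s = (\<Sum>k<d'. 2 * ?Q ?s)" by (simp add: d')
  also have "\<dots> \<le> (\<Sum>k<d'. ?f (nbr v (Suc k, -1)) + ?f (nbr v (Suc k, 1)))"
    by (intro sum_mono) (use S in auto)
  finally have "(2 * real d - 2) * ?Q ?s + (?Q (?s - 1) + ?Q (?s + 1)) \<le>
      (\<Sum>k<d. ?f (nbr v (k, -1)) + ?f (nbr v (k, 1)))"
    using 0 unfolding d' sum.lessThan_Suc_shift by simp
  moreover have "?Q ?s \<le> ?f v" by (rule IH[OF v1])
  ultimately have "minorant d a (Suc t) ?s \<le>
      ?f v / 2 + (\<Sum>k<d. ?f (nbr v (k, -1)) + ?f (nbr v (k, 1))) / (4 * real d)"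
    unfolding minorant_step[OF assms(1,2)] by (intro add_mono divide_right_mono) auto
  also have "\<dots> = ideal_load d m \<xi>0 (Suc t) v"
    by (rule ideal_load_step_inner[symmetric]) (use vH nH cube in blast)+
  finally show ?case .
qed

text \<open>At this time \<open>\<tau> = a\<^sup>2 / 2\<close>: the quadratic part contributes
  \<open>a / 2\<close> and the quartic part takes away at most \<open>5 / 16 * a\<close>.\<close>

lemma minorant_center_ge:
  assumes "d \<ge> 1" "a \<ge> 1"
  shows "minorant d (real a) (d * a\<^sup>2) 0 \<ge> 3 / 16 * real a"
proof -
  define b where "b = real a"
  have b: "b \<ge> 1" using assms by (simp add: b_def)
  define h where "h = 1 / (2 * real d)"
  have h: "h \<ge> 0" by (simp add: h_def)
  have \<tau>: "real (d * a\<^sup>2) * h = b\<^sup>2 / 2" using assms by (simp add: h_def b_def)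
  have "b\<^sup>2 / 2 * (1 - 3 * h) \<le> b\<^sup>2 / 2 * b\<^sup>2"
    using h b one_le_power[OF b, of 2] by (intro mult_left_mono) linarith+
  hence "(3 * (b\<^sup>2 / 2)\<^sup>2 + b\<^sup>2 / 2 * (1 - 3 * h)) / (4 * b ^ 3) \<le> (5 / 4 * b ^ 4) / (4 * b ^ 3)"
    using b by (intro divide_right_mono) (auto simp: power2_eq_square power4_eq_xxxx)
  also have "\<dots> = 5 / 16 * b" using b by (simp add: field_simps power3_eq_cube power4_eq_xxxx)
  finally have "(3 * (b\<^sup>2 / 2)\<^sup>2 + b\<^sup>2 / 2 * (1 - 3 * h)) / (4 * b ^ 3) \<le> 5 / 16 * b" .
  moreover have "b\<^sup>2 / 2 / b = b / 2" using b by (simp add: power2_eq_square)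
  moreover have "minorant d b (d * a\<^sup>2) 0 = b\<^sup>2 / 2 / b - (3 * (b\<^sup>2 / 2)\<^sup>2 + b\<^sup>2 / 2 * (1 - 3 * h)) / (4 * b ^ 3)"
    unfolding minorant_def h_def[symmetric] Let_def \<tau> by simp
  ultimately show ?thesis unfolding b_def[symmetric] by linarith
qed

subsection \<open>Independent blocks of uniform variables\<close>

lemma sets_unif01 [measurable_cong, simp]: "sets unif01 = sets borel"
  and space_unif01 [simp]: "space unif01 = UNIV"
  by (simp_all add: unif01_def)

lemma product_prob_space_unif01: "product_prob_space (\<lambda>_. unif01)"
  by (intro product_prob_spaceI prob_unif01)

lemma prob_space_rounding_space: "prob_space (rounding_space d m)"
  unfolding rounding_space_def by (intro prob_space_PiM prob_unif01)

lemma measure_unif01_atLeast: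
  assumes "0 \<le> q" "q \<le> 1"
  shows "measure unif01 {q..} = 1 - q"
proof -
  have "{0..1} \<inter> {q..} = {q..1}" using assms by auto
  thus ?thesis using assms unfolding unif01_def
    by (subst measure_uniform_measure) auto
qed

lemma prob_all_coordinates_atLeast:
  fixes I :: "'i set"
  assumes "finite J" "J \<subseteq> I" "0 \<le> q" "q \<le> 1"
  shows "measure (\<Pi>\<^sub>M _\<in>I. unif01) {\<omega> \<in> space (\<Pi>\<^sub>M _\<in>I. unif01). \<forall>i\<in>J. \<omega> i \<ge> q} = (1 - q) ^ card J"
proof -
  interpret product_prob_space "\<lambda>_. unif01" I by (rule product_prob_space_unif01)
  have "emeasure (\<Pi>\<^sub>M _\<in>I. unif01) {\<omega> \<in> space (\<Pi>\<^sub>M _\<in>I. unif01). \<forall>i\<in>J. \<omega> i \<in> {q..}}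
      = (\<Prod>i\<in>J. emeasure unif01 {q..})"
    by (rule emeasure_PiM_Collect) (use assms in auto)
  also have "\<dots> = ennreal ((1 - q) ^ card J)"
    using assms by (simp add: M.emeasure_eq_measure measure_unif01_atLeast ennreal_power)
  finally show ?thesis using assms by (simp add: measure_def)
qed

text \<open>Restricting a sample to \<open>I\<close> is the identity on the space, so the joint law
  of the coordinates is the product measure itself, that is, the product of their marginals.\<close>

lemma indep_vars_coordinates:
  fixes I :: "'i set"
  assumes "I \<noteq> {}"
  shows "prob_space.indep_vars (\<Pi>\<^sub>M _\<in>I. unif01) (\<lambda>_. unif01) (\<lambda>i \<omega>. \<omega> i) I"
proof -
  interpret product_prob_space "\<lambda>_. unif01" I by (rule product_prob_space_unif01)
  have "distr (\<Pi>\<^sub>M _\<in>I. unif01) (\<Pi>\<^sub>M _\<in>I. unif01) (\<lambda>\<omega>. \<lambda>i\<in>I. \<omega> i) =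
      distr (\<Pi>\<^sub>M _\<in>I. unif01) (\<Pi>\<^sub>M _\<in>I. unif01) (\<lambda>\<omega>. \<omega>)"
    by (intro distr_cong) (auto simp: space_PiM)
  also have "\<dots> = (\<Pi>\<^sub>M _\<in>I. unif01)" by (rule distr_id)
  also have "\<dots> = (\<Pi>\<^sub>M i\<in>I. distr (\<Pi>\<^sub>M _\<in>I. unif01) unif01 (\<lambda>\<omega>. \<omega> i))"
    by (intro PiM_cong refl PiM_component[symmetric])
  finally show ?thesis
    by (subst P.indep_vars_iff_distr_eq_PiM'[OF assms]) auto
qed

text \<open>Disjoint blocks use disjoint coordinates, hence fail independently, each with
  probability at most \<open>1 - (1 - q) ^ M\<close>.\<close>

lemma prob_some_block_atLeast:
  fixes I :: "'i set"
  assumes K: "\<And>j. j < N \<Longrightarrow> finite (K j)" "\<And>j. j < N \<Longrightarrow> K j \<subseteq> I" "\<And>j. j < N \<Longrightarrow> card (K j) \<le> M"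
    and disj: "disjoint_family_on K {..<N}" and q: "0 \<le> q" "q \<le> 1"
  shows "measure (\<Pi>\<^sub>M _\<in>I. unif01) {\<omega> \<in> space (\<Pi>\<^sub>M _\<in>I. unif01). \<exists>j<N. \<forall>i\<in>K j. \<omega> i \<ge> q}
    \<ge> 1 - (1 - (1 - q) ^ M) ^ N"
proof -
  let ?P = "\<Pi>\<^sub>M _\<in>I. unif01"
  interpret product_prob_space "\<lambda>_. unif01" I by (rule product_prob_space_unif01)
  define A where "A j = {\<omega> \<in> space ?P. \<forall>i\<in>K j. \<omega> i \<ge> q}" for j
  have K': "i \<in> I" if "j < N" "i \<in> K j" for i j using K(2) that by blast
  have A_meas: "A j \<in> sets ?P" if "j < N" for j
    unfolding A_def using K(1)[OF that] K'[OF that] by measurable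
  show ?thesis
  \<comment> \<open>The independence facts ask for nonempty index sets. For \<open>I = {}\<close>
    all blocks are empty, and the event is certain if \<open>N > 0\<close>.\<close>
  proof (cases "N = 0 \<or> I = {}")
    case True
    show ?thesis
    proof (cases "N = 0")
      case False
      with True have "I = {}" by simp
      moreover have "K j = {}" if "j < N" for j using K(2)[OF that] \<open>I = {}\<close> by simp
      ultimately have "{\<omega> \<in> space ?P. \<exists>j<N. \<forall>i\<in>K j. \<omega> i \<ge> q} = space ?P" using False by auto
      thus ?thesis using q by (simp add: P.prob_space power_le_one)
    qed simp
  next
    case False
    have prod: "P.prob (\<Inter>j\<in>{..<N}. space ?P - A j) = (\<Prod>j<N. P.prob (space ?P - A j))"
    proof -
      \<comment> \<open>Failure of a block as an event in its own coordinates only; its preimage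
        under restriction is the complement of \<open>A j\<close>.\<close>
      define B where "B j = {f \<in> space (\<Pi>\<^sub>M _\<in>K j. unif01). \<not> (\<forall>i\<in>K j. f i \<ge> q)}" for j
      have iv: "P.indep_vars (\<lambda>j. PiM (K j) (\<lambda>_. unif01)) (\<lambda>j \<omega>. restrict (\<lambda>i. \<omega> i) (K j)) {..<N}"
        by (rule P.indep_vars_restrict[OF indep_vars_coordinates]) (use False K disj in auto)
      have Bm: "B j \<in> sets (PiM (K j) (\<lambda>_. unif01))" if "j < N" for j
        unfolding B_def using K(1)[OF that] by measurable
      have eq: "(\<lambda>\<omega>. restrict (\<lambda>i. \<omega> i) (K j)) -` B j \<inter> space ?P = space ?P - A j" if "j < N" for j
        using K(2)[OF that] by (auto simp: A_def B_def space_PiM)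
      show ?thesis
      proof -
        have "{..<N} \<noteq> {}" using False by (simp add: lessThan_empty_iff)
        from P.indep_varsD_finite[OF iv this, of B] show ?thesis using Bm
          by (simp add: eq cong: INF_cong_simp prod.cong_simp)
      qed
    qed
    have "P.prob (space ?P - A j) \<le> 1 - (1 - q) ^ M" if j: "j < N" for j
    proof -
      have "P.prob (space ?P - A j) = 1 - P.prob (A j)" by (rule P.prob_compl[OF A_meas[OF j]])
      also have "P.prob (A j) = (1 - q) ^ card (K j)"
        unfolding A_def using K j q by (intro prob_all_coordinates_atLeast) auto
      also have "1 - \<dots> \<le> 1 - (1 - q) ^ M" using K(3)[OF j] q by (simp add: power_decreasing)
      finally show ?thesis .
    qed
    hence "(\<Prod>j<N. P.prob (space ?P - A j)) \<le> (\<Prod>j<N. 1 - (1 - q) ^ M)"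
      by (intro prod_mono) auto
    hence le: "P.prob (\<Inter>j\<in>{..<N}. space ?P - A j) \<le> (1 - (1 - q) ^ M) ^ N" using prod by simp
    have "{\<omega> \<in> space ?P. \<exists>j<N. \<forall>i\<in>K j. \<omega> i \<ge> q} = space ?P - (\<Inter>j\<in>{..<N}. space ?P - A j)"
      using False by (auto simp: A_def)
    also have "P.prob \<dots> = 1 - P.prob (\<Inter>j\<in>{..<N}. space ?P - A j)"
      using A_meas False by (intro P.prob_compl sets.finite_INT) auto
    finally show ?thesis using le by simp
  qed
qed

section \<open>Measurability of the rounded loads\<close>

lemma measurable_rand_round [measurable]:
  assumes [measurable]: "f \<in> borel_measurable M" "g \<in> borel_measurable M"
  shows "(\<lambda>\<omega>. rand_round (f \<omega>) (g \<omega>)) \<in> measurable M (count_space UNIV)"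
  unfolding rand_round_def by measurable

lemma measurable_sum_int:
  fixes f :: "'i \<Rightarrow> 'a \<Rightarrow> int"
  assumes "\<And>i. i \<in> A \<Longrightarrow> f i \<in> measurable M (count_space UNIV)"
  shows "(\<lambda>\<omega>. \<Sum>i\<in>A. f i \<omega>) \<in> measurable M (count_space UNIV)"
  using assms
proof (induction A rule: infinite_finite_induct)
  case (insert i A)
  hence [measurable]: "f i \<in> measurable M (count_space UNIV)"
    "(\<lambda>\<omega>. \<Sum>i\<in>A. f i \<omega>) \<in> measurable M (count_space UNIV)" by auto
  show ?case using insert.hyps by simp
qed simp_all

text \<open>This makes the deviation event measurable, so that monotonicity of the measure applies
  to it.\<close>

lemma measurable_rr_load:
  "(\<lambda>\<omega>. rr_load d m x0 \<omega> t v) \<in> measurable (rounding_space d m) (count_space UNIV)"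
proof (induction t arbitrary: v)
  case (Suc t)
  note [measurable] = Suc
  have [measurable]: "(\<lambda>\<omega>. real_of_int (rr_load d m x0 \<omega> t v)) \<in> borel_measurable (rounding_space d m)" for v
    by (rule measurable_compose[OF Suc]) simp
  have flow [measurable]: "(\<lambda>\<omega>. rr_flow d m (rr_load d m x0 \<omega> t) (\<lambda>e. \<omega> (Suc t, e)) v j)
      \<in> measurable (rounding_space d m) (count_space UNIV)" if "torus_adj d m v j" for j
  proof -
    have "(Suc t, {v, j}) \<in> UNIV \<times> torus_edges d m" using that by (auto simp: torus_edges_def)
    hence [measurable]: "(\<lambda>\<omega>. \<omega> (Suc t, {v, j})) \<in> borel_measurable (rounding_space d m)"
      unfolding rounding_space_def using measurable_component_singleton by fastforce
    show ?thesis unfolding rr_flow_def Let_def by measurable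
  qed
  have "(\<lambda>\<omega>. \<Sum>j | torus_adj d m v j. rr_flow d m (rr_load d m x0 \<omega> t) (\<lambda>e. \<omega> (Suc t, e)) v j)
      \<in> measurable (rounding_space d m) (count_space UNIV)"
    by (rule measurable_sum_int) (use flow in auto)
  thus ?case by simp
qed simp

subsection \<open>Independent wedges along a coordinate axis\<close>

text \<open>Consecutive cubes of side \<open>2 * H + 1\<close> are lined up along coordinate 0 from
  the origin; in the other coordinates the offset \<open>H\<close> makes each cube start at
  0.\<close>

definition center :: "nat \<Rightarrow> nat \<Rightarrow> nat \<Rightarrow> vertex" where
  "center d H j = (\<lambda>k\<in>{..<d}. if k = 0 then int j * (2 * int H + 1) + int H else int H)"

text \<open>The period need not divide \<open>m\<close>, as only complete periods are used.\<close>

definition wedge :: "nat \<Rightarrow> vertex \<Rightarrow> int" where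
  "wedge H v = \<bar>v 0 mod (2 * int H + 1) - int H\<bar>"

lemma cube_eq_PiE: "cube d c r = (\<Pi>\<^sub>E k\<in>{..<d}. {c k - r..c k + r})"
proof (intro set_eqI)
  have "\<bar>x - y\<bar> \<le> r \<longleftrightarrow> x \<in> {y - r..y + r}" for x y by auto
  thus "v \<in> cube d c r \<longleftrightarrow> v \<in> (\<Pi>\<^sub>E k\<in>{..<d}. {c k - r..c k + r})" for v
    unfolding cube_def PiE_iff mem_Collect_eq by blast
qed

lemma finite_cube: "finite (cube d c r)"
  unfolding cube_eq_PiE by (intro finite_PiE) auto

lemma card_cube: "card (cube d c (int H)) = (2 * H + 1) ^ d"
proof -
  have "card {x - int H..x + int H} = 2 * H + 1" for x by simp
  thus ?thesis unfolding cube_eq_PiE by (simp add: card_PiE del: card_atLeastAtMost_int)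
qed

text \<open>The quotient of coordinate 0 by the period recovers the index of the cube, which yields
  disjointness; the remainder gives the value of the wedge.\<close>

lemma cube_center_0:
  assumes "d \<ge> 1" "v \<in> cube d (center d H j) (int H)"
  shows "v 0 div (2 * int H + 1) = int j" "v 0 mod (2 * int H + 1) = v 0 - int j * (2 * int H + 1)"
proof -
  define p where "p = 2 * int H + 1"
  have "\<bar>v 0 - (int j * p + int H)\<bar> \<le> int H"
    using assms by (auto simp: cube_def center_def p_def dest!: spec[of _ "0::nat"])
  hence "0 \<le> v 0 - int j * p" "v 0 - int j * p < p" unfolding p_def by linarith+
  moreover have "v 0 = p * int j + (v 0 - int j * p)" by (simp add: mult.commute)
  ultimately show "v 0 div (2 * int H + 1) = int j"
      "v 0 mod (2 * int H + 1) = v 0 - int j * (2 * int H + 1)"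
    unfolding p_def[symmetric] by (blast intro: int_div_pos_eq int_mod_pos_eq)+
qed

lemma wedge_on_cube:
  assumes "d \<ge> 1" "v \<in> cube d (center d H j) (int H)"
  shows "wedge H v = \<bar>v 0 - center d H j 0\<bar>"
  unfolding wedge_def cube_center_0(2)[OF assms] using assms(1) by (simp add: center_def algebra_simps)

text \<open>The bound on \<open>j\<close> leaves room for \<open>j + 1\<close> complete periods
  below \<open>m\<close>; the other coordinates need only one.\<close>

lemma cube_center_subset:
  assumes "j < m div (2 * H + 1)"
  shows "cube d (center d H j) (int H) \<subseteq> torus_verts d m"
proof -
  have m: "(j + 1) * (2 * H + 1) \<le> m"
    using assms less_eq_div_iff_mult_less_eq[of "2 * H + 1" "j + 1" m] by simp
  have "int ((j + 1) * (2 * H + 1)) \<le> int m" using m by linarith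
  hence m': "int j * (2 * int H + 1) + 2 * int H + 1 \<le> int m" by (simp add: algebra_simps)
  have j0: "0 \<le> int j * (2 * int H + 1)" by simp
  have "{center d H j k - int H..center d H j k + int H} \<subseteq> {0..<int m}" if "k < d" for k
  proof
    fix x assume "x \<in> {center d H j k - int H..center d H j k + int H}"
    moreover have "center d H j k = int j * (2 * int H + 1) + int H \<or> center d H j k = int H"
      using that by (simp add: center_def)
    ultimately have "int j * (2 * int H + 1) \<le> x \<and> x \<le> int j * (2 * int H + 1) + 2 * int H \<or> 0 \<le> x \<and> x \<le> 2 * int H"
      unfolding atLeastAtMost_iff by linarith
    hence "0 \<le> x \<and> x < int m" using m' j0 by linarith
    thus "x \<in> {0..<int m}" by simp
  qed
  thus ?thesis unfolding cube_eq_PiE torus_verts_def by (intro PiE_mono) auto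
qed

section \<open>Rounding variables that govern one cube\<close>

lemma card_edges_within_cube:
  "card {e \<in> torus_edges d m. e \<subseteq> cube d c (int H)} \<le> (2 * H + 1) ^ (2 * d)"
proof -
  let ?C = "cube d c (int H)"
  have "{e \<in> torus_edges d m. e \<subseteq> ?C} \<subseteq> (\<lambda>(i, j). {i, j}) ` (?C \<times> ?C)"
    by (auto simp: torus_edges_def)
  hence "card {e \<in> torus_edges d m. e \<subseteq> ?C} \<le> card (?C \<times> ?C)"
    by (intro surj_card_le) (simp_all add: finite_cube)
  also have "\<dots> = (2 * H + 1) ^ (2 * d)"
    unfolding card_cartesian_product card_cube mult_2 power_add ..
  finally show ?thesis .
qed

text \<open>Times start at 1 because the step from \<open>t\<close> to \<open>Suc t\<close> reads
  the variables with index \<open>Suc t\<close>.\<close>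

definition block :: "nat \<Rightarrow> nat \<Rightarrow> nat \<Rightarrow> nat \<Rightarrow> (nat \<times> vertex set) set" where
  "block d m H j = {1..H} \<times> {e \<in> torus_edges d m. e \<subseteq> cube d (center d H j) (int H)}"

lemma finite_block: "finite (block d m H j)"
  unfolding block_def
  by (intro finite_cartesian_product) (auto intro: finite_subset[OF _ finite_Pow_iff[THEN iffD2, OF finite_cube]])

lemma block_subset: "block d m H j \<subseteq> UNIV \<times> torus_edges d m"
  by (auto simp: block_def)

lemma card_block: "card (block d m H j) \<le> (2 * H + 1) ^ (2 * d + 1)"
proof -
  have "card (block d m H j) \<le> H * (2 * H + 1) ^ (2 * d)"
    unfolding block_def card_cartesian_product using card_edges_within_cube by simp
  also have "\<dots> \<le> (2 * H + 1) * (2 * H + 1) ^ (2 * d)" by (intro mult_right_mono) auto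
  finally show ?thesis by simp
qed

lemma disjoint_blocks:
  assumes "d \<ge> 1"
  shows "disjoint_family_on (block d m H) J"
  unfolding disjoint_family_on_def
proof (intro ballI impI equals0I)
  fix j j' te assume "j \<noteq> j'" and te: "te \<in> block d m H j \<inter> block d m H j'"
  obtain t e where te': "te = (t, e)" by (cases te)
  \<comment> \<open>Edges are nonempty, so a common edge gives a vertex in both cubes.\<close>
  from te te' obtain i where "i \<in> cube d (center d H j) (int H)" "i \<in> cube d (center d H j') (int H)"
    unfolding block_def torus_edges_def by blast
  hence "int j = int j'" using cube_center_0(1)[OF assms] by metis
  thus False using \<open>j \<noteq> j'\<close> by simp
qed

section \<open>Deviation at a frozen center and its probability\<close>

lemma deviation_at_center:
  assumes "d \<ge> 1" "a \<ge> 1" and H: "H = d * a\<^sup>2" and j: "j < m div (2 * H + 1)"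
    and \<omega>: "\<forall>te\<in>block d m H j. \<omega> te \<ge> 1 / (4 * real d)"
  shows "\<bar>real_of_int (rr_load d m (wedge H) \<omega> H (center d H j))
      - ideal_load d m (\<lambda>i. real_of_int (wedge H i)) H (center d H j)\<bar> \<ge> 3 / 16 * real a"
proof -
  let ?c = "center d H j"
  \<comment> \<open>At time \<open>H\<close> the controlled cube has shrunk to its center.\<close>
  have c: "?c \<in> cube d ?c (int H - int H)" by (simp add: cube_def center_def)
  have "rr_load d m (wedge H) \<omega> H ?c = \<bar>?c 0 - ?c 0\<bar>"
  proof (rule rr_load_frozen[OF \<open>d \<ge> 1\<close> cube_center_subset[OF j] _ _ order_refl c])
    fix t e assume "t < H" "e \<in> torus_edges d m" "e \<subseteq> cube d ?c (int H)"
    thus "\<omega> (Suc t, e) \<ge> 1 / (4 * real d)" using \<omega> by (simp add: block_def)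
  qed (use wedge_on_cube assms in blast)
  moreover have "ideal_load d m (\<lambda>i. real_of_int (wedge H i)) H ?c
      \<ge> minorant d (real a) H (real_of_int (?c 0 - ?c 0))"
    by (rule ideal_load_ge_minorant[OF \<open>d \<ge> 1\<close> _ cube_center_subset[OF j] _ order_refl c])
       (use assms in \<open>simp_all add: wedge_on_cube\<close>)
  ultimately show ?thesis using minorant_center_ge[OF assms(1,2)] H by simp
qed

text \<open>With \<open>q = 1 / (4 * d)\<close>, the bounds
  \<open>exp (- 1) \<le> 1 / 2 \<le> 1 - q\<close> and \<open>1 - x \<le> exp (- x)\<close> turn the
  block estimate into a form suited to asymptotics.\<close>

lemma prob_deviation_ge:
  assumes "d \<ge> 1" "a \<ge> 1" and H: "H = d * a\<^sup>2" and L: "L \<le> 3 / 16 * real a"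
  shows "measure (rounding_space d m) {\<omega> \<in> space (rounding_space d m).
      \<exists>v\<in>torus_verts d m. \<exists>t. \<bar>real_of_int (rr_load d m (wedge H) \<omega> t v)
        - ideal_load d m (\<lambda>i. real_of_int (wedge H i)) t v\<bar> \<ge> L}
    \<ge> 1 - exp (- real (m div (2 * H + 1)) * exp (- real ((2 * H + 1) ^ (2 * d + 1))))"
    (is "measure ?P ?S \<ge> _")
proof -
  interpret prob_space ?P by (rule prob_space_rounding_space)
  define N where "N = m div (2 * H + 1)"
  define M where "M = (2 * H + 1) ^ (2 * d + 1)"
  define q where "q = 1 / (4 * real d)"
  have q: "0 \<le> q" "q \<le> 1 / 4" using \<open>d \<ge> 1\<close> by (auto simp: q_def field_simps)
  let ?F = "{\<omega> \<in> space ?P. \<exists>j<N. \<forall>i\<in>block d m H j. \<omega> i \<ge> q}"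
  have S: "?S \<in> sets ?P"
  proof -
    have [measurable]: "(\<lambda>\<omega>. real_of_int (rr_load d m (wedge H) \<omega> t v)) \<in> borel_measurable ?P" for t v
      by (rule measurable_compose[OF measurable_rr_load]) simp
    have "?S = (\<Union>v\<in>torus_verts d m. \<Union>t. {\<omega> \<in> space ?P. \<bar>real_of_int (rr_load d m (wedge H) \<omega> t v)
        - ideal_load d m (\<lambda>i. real_of_int (wedge H i)) t v\<bar> \<ge> L})" by auto
    also have "\<dots> \<in> sets ?P" by (intro sets.finite_UN finite_torus_verts sets.countable_UN) auto
    finally show ?thesis .
  qed
  have "?F \<subseteq> ?S"
  proof safe
    fix \<omega> j assume j: "j < N" and \<omega>: "\<forall>i\<in>block d m H j. \<omega> i \<ge> q"
    have "center d H j \<in> torus_verts d m"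
      using cube_center_subset[of j m H d] j by (auto simp: N_def cube_def center_def)
    moreover have "\<bar>real_of_int (rr_load d m (wedge H) \<omega> H (center d H j))
        - ideal_load d m (\<lambda>i. real_of_int (wedge H i)) H (center d H j)\<bar> \<ge> L"
      using deviation_at_center[OF assms(1,2) H, of j m \<omega>] j \<omega> L unfolding N_def q_def by linarith
    ultimately show "\<exists>v\<in>torus_verts d m. \<exists>t. \<bar>real_of_int (rr_load d m (wedge H) \<omega> t v)
        - ideal_load d m (\<lambda>i. real_of_int (wedge H i)) t v\<bar> \<ge> L" by blast
  qed
  have "1 - exp (- real N * exp (- real M)) \<le> 1 - (1 - (1 - q) ^ M) ^ N"
  proof -
    have "inverse (exp 1) \<le> inverse (2 :: real)"
      using exp_ge_add_one_self[of 1] by (intro le_imp_inverse_le) auto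
    hence "exp (- 1) \<le> 1 - q" using q by (simp add: exp_minus)
    hence "exp (- 1) ^ M \<le> (1 - q) ^ M" by (intro power_mono) auto
    hence "exp (- real M) \<le> (1 - q) ^ M" by (simp flip: exp_of_nat_mult)
    moreover have "1 - (1 - q) ^ M \<le> exp (- ((1 - q) ^ M))"
      using exp_ge_add_one_self[of "- ((1 - q) ^ M)"] by simp
    ultimately have "1 - (1 - q) ^ M \<le> exp (- exp (- real M))"
      by (meson exp_le_cancel_iff neg_le_iff_le order_trans)
    moreover have "0 \<le> 1 - (1 - q) ^ M" using q by (simp add: power_le_one)
    ultimately have "(1 - (1 - q) ^ M) ^ N \<le> exp (- exp (- real M)) ^ N" by (intro power_mono)
    thus ?thesis by (simp flip: exp_of_nat_mult)
  qed
  also have "\<dots> \<le> prob ?F"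
    unfolding rounding_space_def M_def
    by (intro prob_some_block_atLeast finite_block block_subset card_block disjoint_blocks)
       (use q \<open>d \<ge> 1\<close> in auto)
  also have "\<dots> \<le> prob ?S" using \<open>?F \<subseteq> ?S\<close> S by (rule finite_measure_mono)
  finally show ?thesis unfolding N_def M_def .
qed

text \<open>As \<open>d\<close> is fixed, \<open>n = m ^ d\<close> tends to infinity with the side
  length \<open>m\<close>, over which the limit is taken. For large \<open>m\<close>, at least
  \<open>m / ln m - 1\<close> disjoint cubes each freeze with probability at least
  \<open>exp (- (ln m / 2))\<close>, so the chance of no frozen cube vanishes.\<close>

theorem mainTheorem4:
  fixes d :: nat
  assumes "d \<ge> 1"
  shows "\<exists>(c::real) (\<delta>::real). c > 0 \<and> \<delta> > 0 \<and>
    (\<exists>x0 :: nat \<Rightarrow> vertex \<Rightarrow> int.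
      (\<lambda>m. measure (rounding_space d m)
         {\<omega> \<in> space (rounding_space d m).
            \<exists>v\<in>torus_verts d m. \<exists>t.
              \<bar>real_of_int (rr_load d m (x0 m) \<omega> t v)
                 - ideal_load d m (\<lambda>i. real_of_int (x0 m i)) t v\<bar>
              \<ge> c * ln (real (card (torus_verts d m))) powr \<delta>})
      \<longlonglongrightarrow> 1)"
proof -
  \<comment> \<open>The number of roundings in a cube is at most of order
    \<open>a ^ (4 * d + 2)\<close>; the exponent \<open>4 * d + 3\<close> leaves a spare power of
    \<open>y m\<close> to absorb constants.\<close>
  define \<gamma> where "\<gamma> = 1 / real (4 * d + 3)"
  \<comment> \<open>Since \<open>ln n = d * ln m\<close> and \<open>d powr \<gamma> \<le> d\<close>,
    the target is at most \<open>y m / 16\<close>, which is below \<open>3 / 16 * a m\<close> once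
    \<open>a m \<ge> y m / 2\<close>.\<close>
  define c where "c = 1 / (16 * real d)"
  define y where "y m = ln (real m) powr \<gamma>" for m :: nat
  define a where "a m = nat \<lfloor>y m\<rfloor>" for m
  define H where "H m = d * (a m)\<^sup>2" for m
  define K where "K = (3 * real d) ^ (2 * d + 1)"
  let ?L = "\<lambda>m. c * ln (real (card (torus_verts d m))) powr \<gamma>"
  let ?S = "\<lambda>m. {\<omega> \<in> space (rounding_space d m). \<exists>v\<in>torus_verts d m. \<exists>t.
    \<bar>real_of_int (rr_load d m (wedge (H m)) \<omega> t v)
      - ideal_load d m (\<lambda>i. real_of_int (wedge (H m) i)) t v\<bar> \<ge> ?L m}"
  have \<gamma>: "0 < \<gamma>" "\<gamma> \<le> 1" by (auto simp: \<gamma>_def)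
  have ypos: "y m \<ge> 0" for m by (simp add: y_def)
  have y_lim: "filterlim y at_top sequentially"
    unfolding y_def using \<gamma>(1) by real_asymp
  \<comment> \<open>\<open>y m \<ge> 2\<close> ensures that the floor loses at most half, and
    \<open>y m \<ge> 2 * K\<close> pays for the constant \<open>K\<close> in the block size.\<close>
  have large: "eventually (\<lambda>m. y m \<ge> 2 * K \<and> y m \<ge> 2 \<and> m \<ge> 3) sequentially"
    using y_lim by (intro eventually_conj eventually_ge_at_top) (simp_all add: filterlim_at_top)
  have lower: "eventually (\<lambda>m. measure (rounding_space d m) (?S m)
      \<ge> 1 - exp (- ((real m / ln (real m) - 1) * exp (- (ln (real m) / 2))))) sequentially"
    using large
  proof eventually_elim
    case (elim m)
    have m: "ln (real m) > 0" using elim by simp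
    have a: "y m / 2 \<le> real (a m)" "real (a m) \<le> y m" "a m \<ge> 1"
      using elim unfolding a_def by linarith+
    have yp: "y m ^ (4 * d + 3) = ln (real m)"
    proof -
      have "y m ^ (4 * d + 3) = y m powr real (4 * d + 3)" using elim by (subst powr_realpow) auto
      also have "\<dots> = ln (real m)" using m by (simp add: y_def powr_powr \<gamma>_def)
      finally show ?thesis .
    qed
    have L: "?L m \<le> 3 / 16 * real (a m)"
    proof -
      have "ln (real (card (torus_verts d m))) powr \<gamma> = real d powr \<gamma> * y m"
        using elim m by (simp add: card_torus_verts ln_realpow powr_mult y_def)
      also have "\<dots> \<le> real d * y m"
        using powr_mono[of \<gamma> 1 "real d"] \<gamma> \<open>d \<ge> 1\<close> ypos[of m] by (intro mult_right_mono) auto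
      finally have "?L m \<le> c * (real d * y m)" using \<open>d \<ge> 1\<close> by (intro mult_left_mono) (auto simp: c_def)
      also have "\<dots> = y m / 16" using \<open>d \<ge> 1\<close> by (simp add: c_def)
      finally show ?thesis using a by linarith
    qed
    define p where "p = 2 * H m + 1"
    define M where "M = p ^ (2 * d + 1)"
    have M: "real M \<le> ln (real m) / 2"
    proof -
      have "1 \<le> d * (a m)\<^sup>2" using \<open>d \<ge> 1\<close> a(3) by simp
      hence "p \<le> 3 * (d * (a m)\<^sup>2)" unfolding p_def H_def by linarith
      hence "real p \<le> real (3 * (d * (a m)\<^sup>2))" by (rule of_nat_mono)
      also have "\<dots> = 3 * real d * (real (a m))\<^sup>2" by simp
      also have "\<dots> \<le> 3 * real d * (y m)\<^sup>2" using a(2) by (intro mult_left_mono power_mono) auto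
      finally have "real p \<le> 3 * real d * (y m)\<^sup>2" .
      hence "real M \<le> (3 * real d * (y m)\<^sup>2) ^ (2 * d + 1)"
        unfolding M_def of_nat_power by (intro power_mono) auto
      also have "\<dots> = K * y m ^ (2 * (2 * d + 1))" by (simp only: K_def power_mult_distrib power_mult)
      also have "\<dots> \<le> (y m / 2) * y m ^ (2 * (2 * d + 1))"
        using elim ypos[of m] by (intro mult_right_mono) auto
      also have "\<dots> = y m ^ Suc (2 * (2 * d + 1)) / 2" by simp
      also have "Suc (2 * (2 * d + 1)) = 4 * d + 3" by simp
      finally show ?thesis unfolding yp .
    qed
    have p: "0 < real p" "real p \<le> ln (real m)"
    proof -
      show "0 < real p" by (simp add: p_def)
      have "p \<le> M" unfolding M_def by (rule self_le_power) (simp_all add: p_def)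
      thus "real p \<le> ln (real m)" using M m by linarith
    qed
    have "real m / ln (real m) - 1 \<le> real m / real p - 1"
      using p m by (intro diff_right_mono divide_left_mono) auto
    also have "\<dots> \<le> real (m div p)"
    proof -
      have "m \<le> (m div p + 1) * p" using dividend_less_div_times[of p m] p(1) by simp
      hence "real m \<le> (real (m div p) + 1) * real p" by (metis of_nat_le_iff of_nat_mult of_nat_add of_nat_1)
      thus ?thesis using p(1) by (simp add: field_simps)
    qed
    finally have N: "real m / ln (real m) - 1 \<le> real (m div p)" .
    have "(real m / ln (real m) - 1) * exp (- (ln (real m) / 2)) \<le> real (m div p) * exp (- real M)"
      using N M by (intro mult_mono) auto
    hence "1 - exp (- ((real m / ln (real m) - 1) * exp (- (ln (real m) / 2))))
        \<le> 1 - exp (- real (m div p) * exp (- real M))" by simp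
    also have "\<dots> \<le> measure (rounding_space d m) (?S m)"
      unfolding p_def M_def by (rule prob_deviation_ge[OF \<open>d \<ge> 1\<close> a(3) H_def L])
    finally show ?case .
  qed
  have "(\<lambda>m. measure (rounding_space d m) (?S m)) \<longlonglongrightarrow> 1"
  proof (rule tendsto_sandwich[OF lower _ _ tendsto_const])
    show "eventually (\<lambda>m. measure (rounding_space d m) (?S m) \<le> 1) sequentially"
      using prob_space_rounding_space by (simp add: prob_space.prob_le_1)
    \<comment> \<open>The exponent grows like \<open>sqrt m / ln m\<close>.\<close>
    show "(\<lambda>m. 1 - exp (- ((real m / ln (real m) - 1) * exp (- (ln (real m) / 2))))) \<longlonglongrightarrow> 1"
      by real_asymp
  qed
  thus ?thesis using \<gamma> \<open>d \<ge> 1\<close>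
    by (intro exI[of _ c] exI[of _ \<gamma>] conjI exI[of _ "\<lambda>m. wedge (H m)"]) (auto simp: c_def)
qed

end
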